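(* Let $L$ be a lattice that contains no infinite chain, and let $T$ and $S$ be $2$-uniform tolerances on $L$. Then $T$ and $S$ permute (that is, $T\circ S=S\circ T$) if and only if $T$ and $S$ are amicable.
   Context: A tolerance on a lattice $L$ is a reflexive, symmetric relation $T\subseteq L\times L$ that is compatible with the lattice operations (if $(a,b),(c,d)\in T$ then $(a\wedge c,b\wedge d)\in T$ and $(a\vee c,b\vee d)\in T$). The blocks of $T$ are the maximal (with respect to inclusion) subsets $X\subseteq L$ with $X^2\subseteq T$. A tolerance is $2$-uniform if each of its blocks consists of exactly two elements. For tolerances $T,S$ on $L$, $T\circ S=\{(x,z): \text{there exists } y\in L \text{ with } (x,y)\in T \text{ and } (y,z)\in S\}$. We write $v\prec u$ if $v$ is a lower cover of $u$ (equivalently, $u$ is an upper cover of $v$). Let $R$ be a $2$-uniform tolerance on $L$ and $u\in L$. The element $u$ is an $R$-top if there exists $v\prec u$ such that $\{v,u\}$ is an $R$-block. The element $u$ is an $R$-bottom if there exists $w\in L$ with $u\prec w$ such that $\{u,w\}$ is an $R$-block. For $2$-uniform tolerances $T$ and $S$ on $L$, an element is a two-fold $(T,S)$-bottom if it is both a $T$-bottom and an $S$-bottom, and a two-fold $(T,S)$-top if it is both a $T$-top and an $S$-top. $T$ and $S$ are amicable if the following two conditions hold for every $u\in L$ (and every $v\in L$): (A1) if $u$ is a two-fold $(T,S)$-top, $u\prec v$ and $(u,v)\in T\cup S$, then $v$ is a two-fold $(T,S)$-top; (A2) if $u$ is a two-fold $(T,S)$-bottom, $v\prec u$ and $(v,u)\in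 T\cup S$, then $v$ is a two-fold $(T,S)$-bottom. *)

theory Defs
  imports Main
begin

definition tolerance :: "('a::lattice \<times> 'a) set \<Rightarrow> bool" where
  "tolerance T \<longleftrightarrow> refl T \<and> sym T \<and>
     (\<forall>a b c d. (a, b) \<in> T \<longrightarrow> (c, d) \<in> T \<longrightarrow>
        (inf a c, inf b d) \<in> T \<and> (sup a c, sup b d) \<in> T)"

definition block :: "('a \<times> 'a) set \<Rightarrow> 'a set \<Rightarrow> bool" where
  "block T X \<longleftrightarrow> X \<times> X \<subseteq> T \<and> (\<forall>Y. X \<subseteq> Y \<longrightarrow> Y \<times> Y \<subseteq> T \<longrightarrow> Y = X)"

definition two_uniform :: "('a \<times> 'a) set \<Rightarrow> bool" where
  "two_uniform T \<longleftrightarrow> (\<forall>X. block T X \<longrightarrow> card X = 2)"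

definition lower_cover :: "'a::order \<Rightarrow> 'a \<Rightarrow> bool" where
  "lower_cover v u \<longleftrightarrow> v < u \<and> \<not> (\<exists>w. v < w \<and> w < u)"

definition tol_top :: "('a::lattice \<times> 'a) set \<Rightarrow> 'a \<Rightarrow> bool" where
  "tol_top R u \<longleftrightarrow> (\<exists>v. lower_cover v u \<and> block R {v, u})"

definition tol_bottom :: "('a::lattice \<times> 'a) set \<Rightarrow> 'a \<Rightarrow> bool" where
  "tol_bottom R u \<longleftrightarrow> (\<exists>w. lower_cover u w \<and> block R {u, w})"

definition two_fold_top :: "('a::lattice \<times> 'a) set \<Rightarrow> ('a \<times> 'a) set \<Rightarrow> 'a \<Rightarrow> bool" where
  "two_fold_top T S u \<longleftrightarrow> tol_top T u \<and> tol_top S u"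

definition two_fold_bottom :: "('a::lattice \<times> 'a) set \<Rightarrow> ('a \<times> 'a) set \<Rightarrow> 'a \<Rightarrow> bool" where
  "two_fold_bottom T S u \<longleftrightarrow> tol_bottom T u \<and> tol_bottom S u"

definition amicable :: "('a::lattice \<times> 'a) set \<Rightarrow> ('a \<times> 'a) set \<Rightarrow> bool" where
  "amicable T S \<longleftrightarrow>
     (\<forall>u v. two_fold_top T S u \<longrightarrow> lower_cover u v \<longrightarrow> (u, v) \<in> T \<union> S \<longrightarrow> two_fold_top T S v) \<and>
     (\<forall>u v. two_fold_bottom T S u \<longrightarrow> lower_cover v u \<longrightarrow> (v, u) \<in> T \<union> S \<longrightarrow> two_fold_bottom T S v)"

end

theory Submission
  imports Defs
begin

text \<open>
  In a \<open>2\<close>-uniform tolerance every clique has at most two elements, and this forces the relation to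
  look like a family of disjoint paths in the covering graph: related distinct elements form a
  covering pair, every element has at most one related upper cover and at most one related lower
  cover, and it has at least one of the two (\<open>unique_upper\<close>, \<open>unique_lower\<close>, \<open>top_or_bottom\<close>).

  Permutability says that each path \<open>x T y S z\<close> can be completed to a quadrangle by some \<open>w\<close> with
  \<open>x S w T z\<close>. If \<open>y\<close> lies above both \<open>x\<close> and \<open>z\<close>, or below both, then the meet or the join of
  \<open>x\<close> and \<open>z\<close> is such a \<open>w\<close>. So, up to reversal, the only problem is an ascending path
  \<open>x \<prec> y \<prec> z\<close>. It can be completed as soon as \<open>z\<close> has a \<open>T\<close>-lower cover other than \<open>y\<close>, or \<open>x\<close> an
  \<open>S\<close>-upper cover other than \<open>y\<close>: meet or join this cover with \<open>y\<close>. Amicability supplies such a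
  cover if \<open>y\<close> is an \<open>S\<close>-top or a \<open>T\<close>-bottom, except when \<open>x S y T z\<close>, and then \<open>w = y\<close> works. In
  the remaining case, where \<open>y\<close> is neither, a failure at \<open>y\<close> propagates to the element \<open>x\<close> below
  with the roles of \<open>T\<close> and \<open>S\<close> exchanged, and so on forever, contradicting the absence of
  infinite descending chains.

  For the other direction, if the tolerances permute and \<open>u\<close> is a two-fold top with \<open>u \<prec> v\<close> and
  \<open>(u, v) \<in> T\<close>, then completing \<open>v T u S u'\<close>, where \<open>u'\<close> is the \<open>S\<close>-lower cover of \<open>u\<close>, gives an
  \<open>S\<close>-neighbour of \<open>v\<close> that is \<open>T\<close>-related to \<open>u'\<close>; it lies below \<open>v\<close>, since otherwise \<open>T\<close> would
  relate \<open>u'\<close> to an element above \<open>u\<close>, which does not cover \<open>u'\<close>. The other cases are dual or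
  symmetric.
\<close>

section \<open>The structure of a two-uniform tolerance\<close>

text \<open>
  Zorn's lemma. Through it, the bound on the size of blocks becomes a bound on all cliques.
\<close>

lemma clique_subset_block:
  assumes "X \<times> X \<subseteq> T"
  obtains B where "block T B" "X \<subseteq> B"
proof -
  let ?A = "{Y. X \<subseteq> Y \<and> Y \<times> Y \<subseteq> T}"
  have "\<exists>M\<in>?A. \<forall>Y\<in>?A. M \<subseteq> Y \<longrightarrow> Y = M"
  proof (rule subset_Zorn_nonempty)
    show "?A \<noteq> {}" using assms by blast
  next
    fix C assume C: "C \<noteq> {}" "subset.chain ?A C"
    have "a \<in> \<Union>C \<Longrightarrow> b \<in> \<Union>C \<Longrightarrow> (a, b) \<in> T" for a b
    proof -
      assume "a \<in> \<Union>C" "b \<in> \<Union>C"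
      then obtain Y Z where YZ: "Y \<in> C" "Z \<in> C" "a \<in> Y" "b \<in> Z" by blast
      then have "Y \<subseteq> Z \<or> Z \<subseteq> Y" using C(2) unfolding subset.chain_def by blast
      with YZ C(2) show ?thesis unfolding subset.chain_def by blast
    qed
    moreover have "X \<subseteq> \<Union>C" using C unfolding subset.chain_def by blast
    ultimately show "\<Union>C \<in> ?A" by blast
  qed
  then show ?thesis using that unfolding block_def by (smt (verit) mem_Collect_eq order_trans)
qed

locale two_uniform_tolerance =
  fixes T :: "('a::lattice \<times> 'a) set"
  assumes tolerance: "tolerance T" and two_uniform: "two_uniform T"
begin

lemma refl: "(a, a) \<in> T"
  using tolerance unfolding tolerance_def refl_on_def by blast

lemma sym: "(a, b) \<in> T \<Longrightarrow> (b, a) \<in> T"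
  using tolerance unfolding tolerance_def sym_def by blast

lemma inf_closed: "(a, b) \<in> T \<Longrightarrow> (c, d) \<in> T \<Longrightarrow> (inf a c, inf b d) \<in> T"
  using tolerance unfolding tolerance_def by blast

lemma sup_closed: "(a, b) \<in> T \<Longrightarrow> (c, d) \<in> T \<Longrightarrow> (sup a c, sup b d) \<in> T"
  using tolerance unfolding tolerance_def by blast

lemma triangle_free:
  assumes "(a, b) \<in> T" "(b, c) \<in> T" "(a, c) \<in> T"
  shows "a = b \<or> b = c \<or> a = c"
proof (rule ccontr)
  assume distinct: "\<not> ?thesis"
  have "{a, b, c} \<times> {a, b, c} \<subseteq> T" using assms refl sym by blast
  then obtain B where "block T B" and B: "{a, b, c} \<subseteq> B" by (rule clique_subset_block)
  then have "card B = 2" using two_uniform unfolding two_uniform_def by blast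
  moreover from this have "card {a, b, c} \<le> card B"
    using B by (intro card_mono) (auto intro: card_ge_0_finite)
  ultimately show False using distinct by simp
qed

lemma block_pair:
  assumes "(a, b) \<in> T" "a \<noteq> b"
  shows "block T {a, b}"
proof -
  have "Y = {a, b}" if "{a, b} \<subseteq> Y" "Y \<times> Y \<subseteq> T" for Y
    using that assms triangle_free[of a b] by blast
  moreover have "{a, b} \<times> {a, b} \<subseteq> T" using assms refl sym by blast
  ultimately show ?thesis unfolding block_def by blast
qed

lemma ex_neighbour: "\<exists>b. b \<noteq> a \<and> (a, b) \<in> T"
proof -
  have "{a} \<times> {a} \<subseteq> T" using refl by blast
  then obtain B where B: "block T B" "a \<in> B" by (rule clique_subset_block) blast
  then have "card B = 2" using two_uniform unfolding two_uniform_def by blast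
  then have "B \<noteq> {a}" by auto
  with B show ?thesis unfolding block_def by blast
qed

text \<open>Otherwise \<open>inf a b\<close> would form a triangle with \<open>a\<close> and \<open>b\<close>.\<close>

lemma comparable:
  assumes "(a, b) \<in> T"
  shows "a \<le> b \<or> b \<le> a"
proof -
  have "(inf a b, a) \<in> T" using inf_closed[OF sym[OF assms] refl[of a]] by (simp add: inf.commute)
  moreover have "(inf a b, b) \<in> T" using inf_closed[OF assms refl[of b]] by simp
  ultimately have "inf a b = a \<or> a = b \<or> inf a b = b" using triangle_free assms by blast
  then show ?thesis by (metis inf.cobounded1 inf.cobounded2 order_refl)
qed

text \<open>An intermediate element would form a triangle with \<open>a\<close> and \<open>b\<close>.\<close>

lemma no_between:
  assumes "(a, b) \<in> T" "a < c" "c < b"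
  shows False
proof -
  have "(a, c) \<in> T" using inf_closed[OF assms(1) refl[of c]] assms
    by (simp add: inf.absorb1 inf.absorb2 less_imp_le)
  moreover have "(c, b) \<in> T" using sup_closed[OF assms(1) refl[of c]] assms
    by (simp add: sup.absorb1 sup.absorb2 less_imp_le)
  ultimately show False using triangle_free[of a c b] assms by auto
qed

lemma unique_upper:
  assumes "(a, b) \<in> T" "(a, c) \<in> T" "a < b" "a < c"
  shows "b = c"
proof -
  have "(a, sup b c) \<in> T" using sup_closed[OF assms(1,2)] by simp
  then have "\<not> b < sup b c" "\<not> c < sup b c" using no_between assms by blast+
  then show ?thesis by (metis sup.cobounded1 sup.cobounded2 order_less_le)
qed

lemma unique_lower:
  assumes "(b, a) \<in> T" "(c, a) \<in> T" "b < a" "c < a"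
  shows "b = c"
proof -
  have "(inf b c, a) \<in> T" using inf_closed[OF assms(1,2)] by simp
  then have "\<not> inf b c < b" "\<not> inf b c < c" using no_between assms by blast+
  then show ?thesis by (metis inf.cobounded1 inf.cobounded2 order_less_le)
qed

lemma lower_coverI: "(a, b) \<in> T \<Longrightarrow> a < b \<Longrightarrow> lower_cover a b"
  unfolding lower_cover_def using no_between by blast

lemma top_iff: "tol_top T u \<longleftrightarrow> (\<exists>v<u. (v, u) \<in> T)"
proof
  show "\<exists>v<u. (v, u) \<in> T" if "tol_top T u"
    using that unfolding tol_top_def lower_cover_def block_def by blast
  show "tol_top T u" if "\<exists>v<u. (v, u) \<in> T"
    using that block_pair lower_coverI unfolding tol_top_def by blast
qed

lemma bottom_iff: "tol_bottom T u \<longleftrightarrow> (\<exists>w>u. (u, w) \<in> T)"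
proof
  show "\<exists>w>u. (u, w) \<in> T" if "tol_bottom T u"
    using that unfolding tol_bottom_def lower_cover_def block_def by blast
  show "tol_bottom T u" if "\<exists>w>u. (u, w) \<in> T"
    using that block_pair lower_coverI unfolding tol_bottom_def by blast
qed

lemma top_or_bottom: "tol_top T u \<or> tol_bottom T u"
proof -
  obtain b where b: "b \<noteq> u" "(u, b) \<in> T" using ex_neighbour by blast
  with comparable have "b < u \<or> u < b" by (metis order_less_le)
  then show ?thesis unfolding top_iff bottom_iff using b sym by blast
qed

end

section \<open>Permuting tolerances are amicable\<close>

lemma two_fold_top_step:
  assumes "two_uniform_tolerance T" "two_uniform_tolerance S"
    and perm: "T O S \<subseteq> S O T"
    and top: "tol_top S u" and uv: "(u, v) \<in> T" "u < v"
  shows "tol_top S v"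
proof -
  interpret T: two_uniform_tolerance T by fact
  interpret S: two_uniform_tolerance S by fact
  obtain u' where u': "u' < u" "(u', u) \<in> S" using top S.top_iff by blast
  have "(v, u') \<in> T O S" using T.sym[OF uv(1)] S.sym[OF u'(2)] by blast
  then obtain w where w: "(v, w) \<in> S" "(w, u') \<in> T" using perm by blast
  have "\<not> v \<le> w"
  proof
    assume "v \<le> w"
    then have "u < w" using uv by simp
    then show False using T.no_between[OF T.sym[OF w(2)] u'(1)] by blast
  qed
  then have "w < v" using S.comparable[OF w(1)] by (auto simp: order_less_le)
  then show ?thesis using S.top_iff S.sym w(1) by blast
qed

lemma two_fold_bottom_step:
  assumes "two_uniform_tolerance T" "two_uniform_tolerance S"
    and perm: "T O S \<subseteq> S O T"
    and bottom: "tol_bottom S u" and vu: "(v, u) \<in> T" "v < u"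
  shows "tol_bottom S v"
proof -
  interpret T: two_uniform_tolerance T by fact
  interpret S: two_uniform_tolerance S by fact
  obtain u' where u': "u < u'" "(u, u') \<in> S" using bottom S.bottom_iff by blast
  have "(v, u') \<in> T O S" using vu(1) u'(2) by blast
  then obtain w where w: "(v, w) \<in> S" "(w, u') \<in> T" using perm by blast
  have "\<not> w \<le> v"
  proof
    assume "w \<le> v"
    then have "w < u" using vu by simp
    then show False using T.no_between[OF w(2) _ u'(1)] by blast
  qed
  then have "v < w" using S.comparable[OF w(1)] by (auto simp: order_less_le)
  then show ?thesis using S.bottom_iff w(1) by blast
qed

lemma amicable_if_permute:
  assumes T: "two_uniform_tolerance T" and S: "two_uniform_tolerance S"
    and perm: "T O S = S O T"
  shows "amicable T S"
proof -
  interpret T: two_uniform_tolerance T by fact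
  interpret S: two_uniform_tolerance S by fact
  have TS: "T O S \<subseteq> S O T" and ST: "S O T \<subseteq> T O S" using perm by auto
  note top_steps = two_fold_top_step[OF T S TS] two_fold_top_step[OF S T ST]
  note bottom_steps = two_fold_bottom_step[OF T S TS] two_fold_bottom_step[OF S T ST]
  show ?thesis
    unfolding amicable_def two_fold_top_def two_fold_bottom_def
  proof (intro conjI allI impI)
    fix u v
    assume top: "tol_top T u \<and> tol_top S u" and "lower_cover u v" and uv: "(u, v) \<in> T \<union> S"
    then have less: "u < v" unfolding lower_cover_def by blast
    show "tol_top T v" using T.top_iff top_steps(2) top uv less by blast
    show "tol_top S v" using S.top_iff top_steps(1) top uv less by blast
  next
    fix u v
    assume bottom: "tol_bottom T u \<and> tol_bottom S u" and "lower_cover v u"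
      and vu: "(v, u) \<in> T \<union> S"
    then have less: "v < u" unfolding lower_cover_def by blast
    show "tol_bottom T v" using T.bottom_iff bottom_steps(2) bottom vu less by blast
    show "tol_bottom S v" using S.bottom_iff bottom_steps(1) bottom vu less by blast
  qed
qed

section \<open>Completing ascending paths\<close>

text \<open>
  The \<open>S\<close>-upper cover \<open>w\<close> of \<open>x\<close> differs from \<open>y\<close> because \<open>x\<close> and \<open>y\<close> are not \<open>S\<close>-related, so \<open>sup y w\<close> is an \<open>S\<close>-upper cover of \<open>y\<close>
  and hence equals \<open>z\<close>.
\<close>

lemma complete_from_bottom:
  assumes "two_uniform_tolerance T" "two_uniform_tolerance S"
    and xy: "(x, y) \<in> T" "x < y" and yz: "(y, z) \<in> S" "y < z"
    and bottom: "tol_bottom S x" and "(x, y) \<notin> S"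
  shows "(x, z) \<in> S O T"
proof -
  interpret T: two_uniform_tolerance T by fact
  interpret S: two_uniform_tolerance S by fact
  obtain w where w: "x < w" "(x, w) \<in> S" using bottom S.bottom_iff by blast
  have "\<not> w \<le> y"
    using T.no_between[OF xy(1) w(1)] w \<open>(x, y) \<notin> S\<close> by (auto simp: order_le_less)
  then have less: "y < sup y w" by (simp add: less_le_not_le)
  have "(y, sup y w) \<in> S"
    using S.sup_closed[OF S.refl[of y] w(2)] xy by (simp add: sup.absorb1 less_imp_le)
  then have "sup y w = z" using S.unique_upper yz less by blast
  moreover have "(w, sup y w) \<in> T"
    using T.sup_closed[OF xy(1) T.refl[of w]] w by (simp add: sup.absorb2 less_imp_le)
  ultimately show ?thesis using w by blast
qed

text \<open>Order dual: here \<open>w\<close> is the \<open>T\<close>-lower cover of \<open>z\<close>, and \<open>inf y w\<close> equals \<open>x\<close>.\<close>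

lemma complete_from_top:
  assumes "two_uniform_tolerance T" "two_uniform_tolerance S"
    and xy: "(x, y) \<in> T" "x < y" and yz: "(y, z) \<in> S" "y < z"
    and top: "tol_top T z" and "(y, z) \<notin> T"
  shows "(x, z) \<in> S O T"
proof -
  interpret T: two_uniform_tolerance T by fact
  interpret S: two_uniform_tolerance S by fact
  obtain w where w: "w < z" "(w, z) \<in> T" using top T.top_iff by blast
  have "\<not> y \<le> w"
    using S.no_between[OF yz(1) _ w(1)] w \<open>(y, z) \<notin> T\<close> by (auto simp: order_le_less)
  then have less: "inf y w < y" by (simp add: less_le_not_le)
  have "(inf y w, y) \<in> T"
    using T.inf_closed[OF T.refl[of y] w(2)] yz by (simp add: inf.absorb1 less_imp_le)
  then have "inf y w = x" using T.unique_lower xy less by blast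
  moreover have "(inf y w, w) \<in> S"
    using S.inf_closed[OF yz(1) S.refl[of w]] w by (simp add: inf.absorb2 less_imp_le)
  ultimately show ?thesis using w by blast
qed

text \<open>
  Here \<open>y\<close> is neither a two-fold top nor a two-fold bottom, so amicability has to be used further
  down. If \<open>x\<close> is not an \<open>S\<close>-bottom, it has an \<open>S\<close>-lower cover \<open>x'\<close>, and it is not a \<open>T\<close>-top,
  since otherwise \<open>y\<close> would be a two-fold top. So the path \<open>x' S x T y\<close> satisfies the same
  hypotheses with \<open>T\<close> and \<open>S\<close> exchanged. By induction it can be completed, which makes \<open>y\<close> an
  \<open>S\<close>-top, a contradiction.
\<close>

lemma complete_by_descent:
  fixes T S :: "('a::lattice \<times> 'a) set"
  assumes wf: "wf {(a::'a, b). a < b}"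
    and "two_uniform_tolerance T" "two_uniform_tolerance S" "amicable T S"
    and "(x, y) \<in> T" "x < y" "(y, z) \<in> S" "y < z"
    and "\<not> tol_top S y" "\<not> tol_bottom T y"
  shows "(x, z) \<in> S O T"
  using assms(2-)
proof (induction y arbitrary: x z T S rule: wf_induct_rule[OF wf])
  case (1 y)
  interpret T: two_uniform_tolerance T by fact
  interpret S: two_uniform_tolerance S by fact
  show ?case
  proof (cases "tol_bottom S x")
    case True
    moreover have "(x, y) \<notin> S" using S.top_iff 1 by blast
    ultimately show ?thesis using complete_from_bottom 1 by blast
  next
    case False
    then have "tol_top S x" using S.top_or_bottom by blast
    then obtain x' where x': "x' < x" "(x', x) \<in> S" using S.top_iff by blast
    have "\<not> tol_top T x"
    proof
      assume "tol_top T x"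
      then have "two_fold_top T S y"
        using \<open>tol_top S x\<close> \<open>amicable T S\<close> T.lower_coverI[OF \<open>(x, y) \<in> T\<close> \<open>x < y\<close>] \<open>(x, y) \<in> T\<close>
        unfolding amicable_def two_fold_top_def by blast
      then show False using \<open>\<not> tol_top S y\<close> unfolding two_fold_top_def by blast
    qed
    moreover have "amicable S T"
      using \<open>amicable T S\<close> unfolding amicable_def two_fold_top_def two_fold_bottom_def by blast
    ultimately have "(x', y) \<in> T O S"
      using 1 x' False by blast
    then obtain w where w: "(x', w) \<in> T" "(w, y) \<in> S" by blast
    have "\<not> y \<le> w"
    proof
      assume "y \<le> w"
      then have "x < w" using \<open>x < y\<close> by simp
      then show False using T.no_between[OF w(1) x'(1)] by blast
    qed
    then have "w < y" using S.comparable[OF w(2)] by (auto simp: order_less_le)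
    then show ?thesis using S.top_iff w(2) \<open>\<not> tol_top S y\<close> by blast
  qed
qed

lemma complete_ascending:
  fixes T S :: "('a::lattice \<times> 'a) set"
  assumes wf: "wf {(a::'a, b). a < b}"
    and T: "two_uniform_tolerance T" and S: "two_uniform_tolerance S" and amicable: "amicable T S"
    and xy: "(x, y) \<in> T" "x < y" and yz: "(y, z) \<in> S" "y < z"
  shows "(x, z) \<in> S O T"
proof -
  interpret T: two_uniform_tolerance T by fact
  interpret S: two_uniform_tolerance S by fact
  have top: "tol_top T z" if "tol_top S y"
  proof -
    have "two_fold_top T S y" using that T.top_iff xy unfolding two_fold_top_def by blast
    then show ?thesis
      using amicable S.lower_coverI[OF yz] yz unfolding amicable_def two_fold_top_def by blast
  qed
  have bottom: "tol_bottom S x" if "tol_bottom T y"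
  proof -
    have "two_fold_bottom T S y" using that S.bottom_iff yz unfolding two_fold_bottom_def by blast
    then show ?thesis
      using amicable T.lower_coverI[OF xy] xy unfolding amicable_def two_fold_bottom_def by blast
  qed
  consider "(x, y) \<in> S" "(y, z) \<in> T" | "tol_top S y" "(y, z) \<notin> T"
    | "tol_bottom T y" "(x, y) \<notin> S" | "\<not> tol_top S y" "\<not> tol_bottom T y"
    using S.top_iff T.bottom_iff xy yz by blast
  then show ?thesis
  proof cases
    case 1 then show ?thesis by blast
  next
    case 2 then show ?thesis using complete_from_top[OF T S xy yz] top by blast
  next
    case 3 then show ?thesis using complete_from_bottom[OF T S xy yz] bottom by blast
  next
    case 4 then show ?thesis using complete_by_descent[OF wf T S amicable xy yz] by blast
  qed
qed

section \<open>Amicable tolerances permute\<close>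

lemma relcomp_subset_if_amicable:
  fixes T S :: "('a::lattice \<times> 'a) set"
  assumes wf: "wf {(a::'a, b). a < b}"
    and T: "two_uniform_tolerance T" and S: "two_uniform_tolerance S" and amicable: "amicable T S"
  shows "T O S \<subseteq> S O T"
proof
  interpret T: two_uniform_tolerance T by fact
  interpret S: two_uniform_tolerance S by fact
  fix p assume "p \<in> T O S"
  then obtain x y z where p: "p = (x, z)" and xy: "(x, y) \<in> T" and yz: "(y, z) \<in> S" by blast
  have amicable': "amicable S T"
    using amicable unfolding amicable_def two_fold_top_def two_fold_bottom_def by blast
  consider "x = y" | "y = z" | "x < y" "y < z" | "z < y" "y < x" | "x < y" "z < y" | "y < x" "y < z"
    using T.comparable[OF xy] S.comparable[OF yz] by (auto simp: order_le_less)
  then have "(x, z) \<in> S O T"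
  proof cases
    case 1 then show ?thesis using yz T.refl by blast
  next
    case 2 then show ?thesis using xy S.refl by blast
  next
    case 3 then show ?thesis using complete_ascending[OF wf T S amicable] xy yz by blast
  next
    case 4
    \<comment> \<open>Read backwards, the path ascends and the tolerances are exchanged.\<close>
    then have "(z, x) \<in> T O S"
      using complete_ascending[OF wf S T amicable'] S.sym[OF yz] T.sym[OF xy] by blast
    then show ?thesis using T.sym S.sym by blast
  next
    case 5
    have "(x, inf x z) \<in> S"
      using S.inf_closed[OF S.refl[of x] yz] 5 by (simp add: inf.absorb1 less_imp_le)
    moreover have "(inf x z, z) \<in> T"
      using T.inf_closed[OF xy T.refl[of z]] 5 by (simp add: inf.absorb2 less_imp_le)
    ultimately show ?thesis by blast
  next
    case 6
    have "(x, sup x z) \<in> S"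
      using S.sup_closed[OF S.refl[of x] yz] 6 by (simp add: sup.absorb1 less_imp_le)
    moreover have "(sup x z, z) \<in> T"
      using T.sup_closed[OF xy T.refl[of z]] 6 by (simp add: sup.absorb2 less_imp_le)
    ultimately show ?thesis by blast
  qed
  then show "p \<in> S O T" using p by simp
qed

lemma wf_less_if_chains_finite:
  assumes "\<And>C :: 'a::order set. Complete_Partial_Order.chain (\<le>) C \<Longrightarrow> finite C"
  shows "wf {(a::'a, b). a < b}"
  unfolding wf_iff_no_infinite_down_chain
proof
  assume "\<exists>f. \<forall>i. (f (Suc i), f i) \<in> {(a::'a, b). a < b}"
  then obtain f :: "nat \<Rightarrow> 'a" where f: "\<And>i. f (Suc i) < f i" by blast
  have descending: "f j < f i" if "i < j" for i j
    using that by (induction rule: less_Suc_induct) (auto intro: f less_trans)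
  have "f i \<le> f j \<or> f j \<le> f i" for i j
    using descending[of i j] descending[of j i] by (cases i j rule: linorder_cases) auto
  then have "Complete_Partial_Order.chain (\<le>) (range f)" by (auto intro: chainI)
  then have "finite (range f)" by (rule assms)
  moreover have "inj f" by (intro injI) (metis descending linorder_neqE_nat less_irrefl)
  ultimately show False using finite_imageD infinite_UNIV_nat by blast
qed

theorem theorem1p1:
  fixes T S :: "('a::lattice \<times> 'a) set"
  assumes no_infinite_chain: "\<And>C :: 'a set. Complete_Partial_Order.chain (\<le>) C \<Longrightarrow> finite C"
    and "tolerance T" and "two_uniform T"
    and "tolerance S" and "two_uniform S"
  shows "T O S = S O T \<longleftrightarrow> amicable T S"
proof
  have T: "two_uniform_tolerance T" and S: "two_uniform_tolerance S"
    using assms by (simp_all add: two_uniform_tolerance_def)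
  show "amicable T S" if "T O S = S O T"
    using amicable_if_permute[OF T S that] .
  assume amicable: "amicable T S"
  have amicable': "amicable S T"
    using amicable unfolding amicable_def two_fold_top_def two_fold_bottom_def by blast
  have wf: "wf {(a::'a, b). a < b}"
    using no_infinite_chain by (rule wf_less_if_chains_finite)
  show "T O S = S O T"
    using relcomp_subset_if_amicable[OF wf T S amicable]
      relcomp_subset_if_amicable[OF wf S T amicable'] by (rule equalityI)
qed

end
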